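(* Let $(\mathbb{R}^n,g)$, $n\ge 3$, be a pseudo-Euclidean space with coordinates $x=(x_1,\dots,x_n)$ and metric components $g_{ij}=\delta_{ij}\varepsilon_i$, $1\le i,j\le n$, where $\varepsilon_i=\pm1$. Let $\rho\in\mathbb{R}$, $\rho\neq 0$, and let $h:\mathbb{R}^n\to\mathbb{R}$ be a smooth function. There exists a metric $\bar g=\frac{1}{\psi^2}g$ such that $(\mathbb{R}^n,\bar g)$ is a gradient $\rho$-Einstein soliton with $h$ as a potential function (with constant $\lambda\in\mathbb{R}$) if and only if the functions $\psi$ and $h$ satisfy $$(n-2)\psi_{,x_ix_j}+\psi h_{,x_ix_j}+\psi_{,x_i}h_{,x_j}+\psi_{,x_j}h_{,x_i}=0\qquad\text{for all } i\neq j,$$ and, for all $i$, $$\psi\left[(n-2)\psi_{,x_ix_i}+\psi h_{,x_ix_i}+2\psi_{,x_i}h_{,x_i}\right]+\varepsilon_i\sum_{k=1}^n\varepsilon_k\left[(n-1)\left(\rho n\psi_{,x_k}^2-2\rho\psi\psi_{,x_kx_k}-\psi_{,x_k}^2\right)-\psi\psi_{,x_k}h_{,x_k}+\psi\psi_{,x_kx_k}\right]=\lambda\varepsilon_i .$$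
   Context: A semi-Riemannian manifold $(M^n,\bar g)$, $n\ge3$, is a gradient $\rho$-Einstein soliton ($\rho\in\mathbb{R}$, $\rho\ne0$) with potential function $h$ (a smooth function $h:M\to\mathbb{R}$) if $\mathrm{Ric}_{\bar g}+\mathrm{Hess}_{\bar g}h=\rho K_{\bar g}\,\bar g+\lambda\bar g$ for some constant $\lambda\in\mathbb{R}$, where $K_{\bar g}$ is the scalar curvature of $\bar g$. Subscripts $\psi_{,x_i}$, $\psi_{,x_ix_j}$, $h_{,x_i}$, $h_{,x_ix_j}$ denote first and second partial derivatives with respect to the coordinates; $\delta_{ij}$ is the Kronecker delta. *)

theory Defs
  imports "HOL-Analysis.Analysis"
begin

definition partial_deriv :: "'n::finite \<Rightarrow> (real^'n \<Rightarrow> real) \<Rightarrow> real^'n \<Rightarrow> real" where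
  "partial_deriv i f x = deriv (\<lambda>t. f (x + t *\<^sub>R axis i 1)) 0"

text \<open>Since \<^const>\<open>deriv\<close> is a total function, differentiability at each stage is
  required explicitly.\<close>

fun C_class :: "nat \<Rightarrow> (real^'n::finite \<Rightarrow> real) \<Rightarrow> bool" where
  "C_class 0 f \<longleftrightarrow> continuous_on UNIV f"
| "C_class (Suc k) f \<longleftrightarrow>
     (\<forall>x. f differentiable (at x)) \<and> (\<forall>i. C_class k (partial_deriv i f))"

definition smooth :: "(real^'n::finite \<Rightarrow> real) \<Rightarrow> bool" where
  "smooth f \<longleftrightarrow> (\<forall>k. C_class k f)"

text \<open>A tensor field is given by its components in the standard global coordinates.
  The index of a continuous field of nondegenerate symmetric forms is constant on the connected
  space R^n, so constancy of the index is not a separate requirement.\<close>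

type_synonym 'n metric_field = "real^'n \<Rightarrow> real^'n^'n"

definition semi_riemannian_metric :: "'n::finite metric_field \<Rightarrow> bool" where
  "semi_riemannian_metric g \<longleftrightarrow>
     (\<forall>i j. smooth (\<lambda>x. g x $ i $ j)) \<and>
     (\<forall>x. transpose (g x) = g x) \<and>
     (\<forall>x. invertible (g x))"

text \<open>\<open>christoffel g l i j\<close> is \<open>\<Gamma>\<^sup>l\<^sub>i\<^sub>j\<close>, the Levi-Civita connection being
  \<open>\<nabla>\<^sub>i \<partial>\<^sub>j = \<Sum>\<^sub>l \<Gamma>\<^sup>l\<^sub>i\<^sub>j \<partial>\<^sub>l\<close>.\<close>

definition christoffel :: "'n::finite metric_field \<Rightarrow> 'n \<Rightarrow> 'n \<Rightarrow> 'n \<Rightarrow> real^'n \<Rightarrow> real" where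
  "christoffel g l i j x =
     (1/2) * (\<Sum>m\<in>UNIV. matrix_inv (g x) $ l $ m *
        (partial_deriv i (\<lambda>y. g y $ j $ m) x
         + partial_deriv j (\<lambda>y. g y $ i $ m) x
         - partial_deriv m (\<lambda>y. g y $ i $ j) x))"

text \<open>\<open>riemann g l k i j\<close> is the \<open>\<partial>\<^sub>l\<close>-component of \<open>R(\<partial>\<^sub>i, \<partial>\<^sub>j) \<partial>\<^sub>k\<close> with
  \<open>R(X,Y)Z = \<nabla>\<^sub>X \<nabla>\<^sub>Y Z - \<nabla>\<^sub>Y \<nabla>\<^sub>X Z - \<nabla>\<^sub>[\<^sub>X\<^sub>,\<^sub>Y\<^sub>] Z\<close>. The Ricci tensor is
  \<open>Ric(Y,Z) = trace (X \<mapsto> R(X,Y)Z)\<close>; it is positive on round spheres.\<close>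

definition riemann ::
  "'n::finite metric_field \<Rightarrow> 'n \<Rightarrow> 'n \<Rightarrow> 'n \<Rightarrow> 'n \<Rightarrow> real^'n \<Rightarrow> real" where
  "riemann g l k i j x =
     partial_deriv i (christoffel g l j k) x - partial_deriv j (christoffel g l i k) x
     + (\<Sum>m\<in>UNIV. christoffel g l i m x * christoffel g m j k x
                   - christoffel g l j m x * christoffel g m i k x)"

definition ricci :: "'n::finite metric_field \<Rightarrow> 'n \<Rightarrow> 'n \<Rightarrow> real^'n \<Rightarrow> real" where
  "ricci g j k x = (\<Sum>i\<in>UNIV. riemann g i k i j x)"

definition scalar_curvature :: "'n::finite metric_field \<Rightarrow> real^'n \<Rightarrow> real" where
  "scalar_curvature g x = (\<Sum>i\<in>UNIV. \<Sum>j\<in>UNIV. matrix_inv (g x) $ i $ j * ricci g i j x)"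

text \<open>Components of \<open>Hess h (X,Y) = X (Y h) - (\<nabla>\<^sub>X Y) h\<close>.\<close>

definition hessian ::
  "'n::finite metric_field \<Rightarrow> (real^'n \<Rightarrow> real) \<Rightarrow> 'n \<Rightarrow> 'n \<Rightarrow> real^'n \<Rightarrow> real" where
  "hessian g h i j x =
     partial_deriv i (partial_deriv j h) x
     - (\<Sum>l\<in>UNIV. christoffel g l i j x * partial_deriv l h x)"

definition soliton_with_constant ::
  "'n::finite metric_field \<Rightarrow> (real^'n \<Rightarrow> real) \<Rightarrow> real \<Rightarrow> real \<Rightarrow> bool" where
  "soliton_with_constant g h \<rho> lam \<longleftrightarrow>
     CARD('n) \<ge> 3 \<and> \<rho> \<noteq> 0 \<and> semi_riemannian_metric g \<and> smooth h \<and>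
     (\<forall>x i j. ricci g i j x + hessian g h i j x
        = \<rho> * scalar_curvature g x * (g x $ i $ j) + lam * (g x $ i $ j))"

definition gradient_rho_einstein_soliton ::
  "'n::finite metric_field \<Rightarrow> (real^'n \<Rightarrow> real) \<Rightarrow> real \<Rightarrow> bool" where
  "gradient_rho_einstein_soliton g h \<rho> \<longleftrightarrow> (\<exists>lam. soliton_with_constant g h \<rho> lam)"

definition pseudo_euclidean :: "('n::finite \<Rightarrow> real) \<Rightarrow> 'n metric_field" where
  "pseudo_euclidean \<epsilon> = (\<lambda>x. \<chi> i j. if i = j then \<epsilon> i else 0)"

text \<open>\<open>(1/\<psi>\<^sup>2) g\<close>; this is a metric only where \<open>\<psi>\<close> does not vanish.\<close>

definition conformal_metric ::
  "(real^'n::finite \<Rightarrow> real) \<Rightarrow> 'n metric_field \<Rightarrow> 'n metric_field" where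
  "conformal_metric \<psi> g = (\<lambda>x. (1 / (\<psi> x)\<^sup>2) *\<^sub>R g x)"

definition conformal_factor :: "(real^'n::finite \<Rightarrow> real) \<Rightarrow> bool" where
  "conformal_factor \<psi> \<longleftrightarrow> smooth \<psi> \<and> (\<forall>x. \<psi> x \<noteq> 0)"

text \<open>In both definitions \<open>\<psi>\<^sub>,\<^sub>x\<^sub>i\<^sub>x\<^sub>j\<close> is \<open>partial_deriv j (partial_deriv i \<psi>)\<close>.\<close>

definition off_diagonal_equations ::
  "(real^'n::finite \<Rightarrow> real) \<Rightarrow> (real^'n \<Rightarrow> real) \<Rightarrow> bool" where
  "off_diagonal_equations \<psi> h \<longleftrightarrow>
     (\<forall>x i j. i \<noteq> j \<longrightarrow>
        (real CARD('n) - 2) * partial_deriv j (partial_deriv i \<psi>) x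
        + \<psi> x * partial_deriv j (partial_deriv i h) x
        + partial_deriv i \<psi> x * partial_deriv j h x
        + partial_deriv j \<psi> x * partial_deriv i h x = 0)"

definition diagonal_equations ::
  "('n::finite \<Rightarrow> real) \<Rightarrow> real \<Rightarrow> real \<Rightarrow> (real^'n \<Rightarrow> real) \<Rightarrow> (real^'n \<Rightarrow> real) \<Rightarrow> bool" where
  "diagonal_equations \<epsilon> \<rho> lam \<psi> h \<longleftrightarrow>
     (\<forall>x i.
        \<psi> x * ((real CARD('n) - 2) * partial_deriv i (partial_deriv i \<psi>) x
                + \<psi> x * partial_deriv i (partial_deriv i h) x
                + 2 * partial_deriv i \<psi> x * partial_deriv i h x)
        + \<epsilon> i * (\<Sum>k\<in>UNIV. \<epsilon> k *
            ((real CARD('n) - 1) *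
               (\<rho> * real CARD('n) * (partial_deriv k \<psi> x)\<^sup>2
                - 2 * \<rho> * \<psi> x * partial_deriv k (partial_deriv k \<psi>) x
                - (partial_deriv k \<psi> x)\<^sup>2)
             - \<psi> x * partial_deriv k \<psi> x * partial_deriv k h x
             + \<psi> x * partial_deriv k (partial_deriv k \<psi>) x))
        = lam * \<epsilon> i)"

end

theory Submission
  imports Defs
begin

text \<open>The metric is conformally flat, so everything is explicit. The Christoffel symbols are
  \<open>- \<psi>\<^sub>i/\<psi> \<delta>\<^sub>j\<^sub>l - \<psi>\<^sub>j/\<psi> \<delta>\<^sub>i\<^sub>l + \<epsilon>\<^sub>l \<epsilon>\<^sub>i \<psi>\<^sub>l/\<psi> \<delta>\<^sub>i\<^sub>j\<close>; with \<open>L = \<Sum>\<^sub>m \<epsilon>\<^sub>m \<psi>\<^sub>m\<^sub>m\<close> and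
  \<open>G = \<Sum>\<^sub>m \<epsilon>\<^sub>m \<psi>\<^sub>m\<^sup>2\<close> this gives
  \<open>Ric\<^sub>j\<^sub>k = (n-2) \<psi>\<^sub>j\<^sub>k/\<psi> + \<epsilon>\<^sub>j \<delta>\<^sub>j\<^sub>k (L/\<psi> - (n-1) G/\<psi>\<^sup>2)\<close> and
  \<open>K = (n-1) (2 \<psi> L - n G)\<close>. Multiplied by \<open>\<psi>\<close>, the off-diagonal components of the soliton
  equation become the first system; multiplied by \<open>\<psi>\<^sup>2\<close>, the diagonal ones become the second.\<close>

section \<open>Calculus of partial derivatives along coordinate lines\<close>

lemma partial_deriv_DERIV:
  fixes f :: "real^'n::finite \<Rightarrow> real"
  assumes "f differentiable (at x)"
  shows "((\<lambda>t. f (x + t *\<^sub>R axis i 1)) has_real_derivative partial_deriv i f x) (at 0)"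
proof -
  have "(\<lambda>s. f (x + s *\<^sub>R axis i 1)) differentiable (at 0)"
    by (rule differentiable_compose[where f = f]) (auto intro!: assms)
  then show ?thesis
    unfolding partial_deriv_def by (metis DERIV_deriv_iff_real_differentiable)
qed

text \<open>The definition differentiates at parameter 0 only; moving the base point along the line
  gives the derivative at every parameter, which the mean value theorem requires.\<close>

lemma partial_deriv_line:
  fixes f :: "real^'n::finite \<Rightarrow> real"
  assumes "\<And>y. f differentiable (at y)"
  shows "((\<lambda>t. f (x + t *\<^sub>R axis i 1)) has_real_derivative partial_deriv i f (x + t *\<^sub>R axis i 1)) (at t)"
proof -
  have "((\<lambda>s. f (x + (s + t) *\<^sub>R axis i 1)) has_real_derivative
      partial_deriv i f (x + t *\<^sub>R axis i 1)) (at 0)"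
    using partial_deriv_DERIV[OF assms, of "x + t *\<^sub>R axis i 1" i] by (simp add: algebra_simps)
  then show ?thesis
    using DERIV_shift[of "\<lambda>r. f (x + r *\<^sub>R axis i 1)" _ 0 t] by simp
qed

lemma partial_deriv_add:
  assumes "f differentiable (at x)" "g differentiable (at x)"
  shows "partial_deriv i (\<lambda>y. f y + g y) x = partial_deriv i f x + partial_deriv i g x"
  unfolding partial_deriv_def[of i "\<lambda>y. f y + g y"]
  by (intro DERIV_imp_deriv DERIV_add partial_deriv_DERIV assms)

lemma partial_deriv_mult:
  assumes "f differentiable (at x)" "g differentiable (at x)"
  shows "partial_deriv i (\<lambda>y. f y * g y) x = f x * partial_deriv i g x + partial_deriv i f x * g x"
  unfolding partial_deriv_def[of i "\<lambda>y. f y * g y"]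
  by (rule DERIV_imp_deriv)
    (use DERIV_mult'[OF partial_deriv_DERIV[OF assms(1)] partial_deriv_DERIV[OF assms(2)]] in simp)

lemma partial_deriv_inverse:
  assumes "f differentiable (at x)" "f x \<noteq> 0"
  shows "partial_deriv i (\<lambda>y. inverse (f y)) x = - (partial_deriv i f x * (inverse (f x) * inverse (f x)))"
  unfolding partial_deriv_def[of i "\<lambda>y. inverse (f y)"]
  by (rule DERIV_imp_deriv)
    (use DERIV_inverse_fun[OF partial_deriv_DERIV[OF assms(1)]] assms(2) in \<open>simp add: power2_eq_square mult.assoc\<close>)

lemma partial_deriv_const: "partial_deriv i (\<lambda>y. c) x = 0"
  unfolding partial_deriv_def by simp

lemma partial_deriv_cmult:
  assumes "f differentiable (at x)"
  shows "partial_deriv i (\<lambda>y. c * f y) x = c * partial_deriv i f x"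
  using partial_deriv_mult[of "\<lambda>_. c", OF _ assms] by (simp add: partial_deriv_const)

section \<open>Closure of smooth functions under algebraic operations\<close>

lemma C_class_mono_Suc: "C_class (Suc k) f \<Longrightarrow> C_class k f"
proof (induction k arbitrary: f)
  case 0
  then show ?case
    by (auto intro!: continuous_at_imp_continuous_on differentiable_imp_continuous_within)
qed auto

lemma C_class_const: "C_class k (\<lambda>_ :: real^'n::finite. c)"
proof (induction k arbitrary: c)
  case (Suc k)
  have "partial_deriv i (\<lambda>_ :: real^'n. c) = (\<lambda>_. 0)" for i
    by (auto simp: partial_deriv_const)
  then show ?case
    using Suc by simp
qed simp

lemma C_class_add: "C_class k f \<Longrightarrow> C_class k g \<Longrightarrow> C_class k (\<lambda>x. f x + g x)"
proof (induction k arbitrary: f g)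
  case 0
  then show ?case by (auto intro: continuous_intros)
next
  case (Suc k)
  then have "partial_deriv i (\<lambda>x. f x + g x) = (\<lambda>x. partial_deriv i f x + partial_deriv i g x)" for i
    by (auto simp: partial_deriv_add)
  then show ?case
    using Suc by auto
qed

lemma C_class_mult: "C_class k f \<Longrightarrow> C_class k g \<Longrightarrow> C_class k (\<lambda>x. f x * g x)"
proof (induction k arbitrary: f g)
  case 0
  then show ?case by (auto intro: continuous_intros)
next
  case (Suc k)
  then have "partial_deriv i (\<lambda>x. f x * g x) = (\<lambda>x. f x * partial_deriv i g x + partial_deriv i f x * g x)" for i
    by (auto simp: partial_deriv_mult)
  \<comment> \<open>The product rule keeps one factor undifferentiated, so its regularity has to be
    lowered by one order before the induction hypothesis applies.\<close>
  moreover have "C_class k f" "C_class k g"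
    using Suc.prems C_class_mono_Suc by blast+
  ultimately show ?case
    using Suc by (auto intro!: C_class_add Suc.IH)
qed

text \<open>The derivative of \<open>1/f\<close> is a product of \<open>partial_deriv i f\<close>
  with copies of \<open>1/f\<close>, whose regularity is the induction hypothesis; closure under
  products does the rest.\<close>

lemma C_class_inverse:
  assumes "\<And>x. f x \<noteq> 0"
  shows "C_class k f \<Longrightarrow> C_class k (\<lambda>x. inverse (f x))"
proof (induction k)
  case 0
  then show ?case using assms by (auto intro: continuous_intros)
next
  case (Suc k)
  then have "partial_deriv i (\<lambda>x. inverse (f x)) =
      (\<lambda>x. (-1) * (partial_deriv i f x * (inverse (f x) * inverse (f x))))" for i
    using assms by (auto simp: partial_deriv_inverse)
  moreover have "C_class k (\<lambda>x. inverse (f x))"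
    using Suc C_class_mono_Suc by blast
  then have "C_class k (\<lambda>x. (-1) * (partial_deriv i f x * (inverse (f x) * inverse (f x))))" for i
    using Suc.prems by (intro C_class_mult C_class_const) auto
  ultimately show ?case
    using Suc.prems assms by (auto intro: differentiable_inverse)
qed

lemma smooth_mult: "smooth f \<Longrightarrow> smooth g \<Longrightarrow> smooth (\<lambda>x. f x * g x)"
  and smooth_const: "smooth (\<lambda>_. c)"
  and smooth_inverse: "smooth f \<Longrightarrow> (\<And>x. f x \<noteq> 0) \<Longrightarrow> smooth (\<lambda>x. inverse (f x))"
  by (auto simp: smooth_def C_class_mult C_class_const C_class_inverse)

lemma smooth_differentiable: "smooth f \<Longrightarrow> f differentiable (at x)"
  unfolding smooth_def using C_class.simps(2) by blast

lemma smooth_partial_deriv: "smooth f \<Longrightarrow> smooth (partial_deriv i f)"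
  unfolding smooth_def using C_class.simps(2) by blast

lemma smooth_isCont: "smooth f \<Longrightarrow> isCont f x"
  by (intro differentiable_imp_continuous_within smooth_differentiable)

section \<open>Symmetry of second partial derivatives\<close>

lemma second_difference_mean_value:
  fixes f :: "real^'n::finite \<Rightarrow> real"
  assumes "smooth f" "0 < s"
  obtains a b where "0 < a" "a < s" "0 < b" "b < s"
    "f (x + s *\<^sub>R axis i 1 + s *\<^sub>R axis j 1) - f (x + s *\<^sub>R axis i 1) - f (x + s *\<^sub>R axis j 1) + f x
     = s * (s * partial_deriv j (partial_deriv i f) (x + a *\<^sub>R axis i 1 + b *\<^sub>R axis j 1))"
proof -
  let ?e = "axis i 1 :: real^'n" and ?d = "axis j 1 :: real^'n"
  \<comment> \<open>The second difference is the increment of \<open>?F\<close> over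
    \<open>[0, s]\<close>. The mean value theorem in direction \<open>i\<close> turns it into an
    increment of \<open>partial_deriv i f\<close> in direction \<open>j\<close>, to which the
    theorem is applied again.\<close>
  let ?F = "\<lambda>t. f ((x + s *\<^sub>R ?d) + t *\<^sub>R ?e) - f (x + t *\<^sub>R ?e)"
  let ?F' = "\<lambda>t. partial_deriv i f ((x + s *\<^sub>R ?d) + t *\<^sub>R ?e) - partial_deriv i f (x + t *\<^sub>R ?e)"
  have "(?F has_real_derivative ?F' t) (at t)" for t
    by (intro DERIV_diff partial_deriv_line smooth_differentiable assms)
  then obtain a where a: "0 < a" "a < s" "?F s - ?F 0 = (s - 0) * ?F' a"
    using MVT2[of 0 s ?F ?F'] assms by blast
  let ?G = "\<lambda>t. partial_deriv i f ((x + a *\<^sub>R ?e) + t *\<^sub>R ?d)"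
  let ?G' = "\<lambda>t. partial_deriv j (partial_deriv i f) ((x + a *\<^sub>R ?e) + t *\<^sub>R ?d)"
  have "(?G has_real_derivative ?G' t) (at t)" for t
    by (intro partial_deriv_line smooth_differentiable smooth_partial_deriv assms)
  then obtain b where b: "0 < b" "b < s" "?G s - ?G 0 = (s - 0) * ?G' b"
    using MVT2[of 0 s ?G ?G'] assms by blast
  show thesis
    using a b by (intro that[of a b]) (simp_all add: ac_simps)
qed

text \<open>Both mixed derivatives, at suitable points close to \<open>x\<close>, equal the same
  second difference divided by the square of \<open>s\<close>. By continuity at \<open>x\<close>
  they cannot differ there.\<close>

lemma partial_deriv_commute:
  fixes f :: "real^'n::finite \<Rightarrow> real"
  assumes "smooth f"
  shows "partial_deriv i (partial_deriv j f) x = partial_deriv j (partial_deriv i f) x"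
proof (rule ccontr)
  let ?P = "partial_deriv i (partial_deriv j f)" and ?Q = "partial_deriv j (partial_deriv i f)"
  assume "?P x \<noteq> ?Q x"
  \<comment> \<open>With half the distance as tolerance, a common value within \<open>e\<close> of
    both \<open>?P x\<close> and \<open>?Q x\<close> violates the triangle inequality.\<close>
  define e where "e = dist (?P x) (?Q x) / 2"
  have "e > 0"
    using \<open>?P x \<noteq> ?Q x\<close> by (simp add: e_def)
  have "isCont ?P x" "isCont ?Q x"
    by (intro smooth_isCont smooth_partial_deriv assms)+
  then obtain r1 r2 where r: "r1 > 0" "r2 > 0"
    "\<And>y. dist y x < r1 \<Longrightarrow> dist (?P y) (?P x) < e"
    "\<And>y. dist y x < r2 \<Longrightarrow> dist (?Q y) (?Q x) < e"
    using \<open>e > 0\<close> unfolding continuous_at_eps_delta by (metis dist_commute)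
  \<comment> \<open>Two displacements shorter than \<open>s\<close> add up to less than
    \<open>min r1 r2\<close>.\<close>
  define s where "s = min r1 r2 / 2"
  have "s > 0"
    using r by (simp add: s_def)
  have near: "dist (x + a *\<^sub>R axis k 1 + b *\<^sub>R axis l 1) x < min r1 r2"
    if "0 < a" "a < s" "0 < b" "b < s" for a b and k l :: 'n
  proof -
    have "dist (x + a *\<^sub>R axis k 1 + b *\<^sub>R axis l 1) x = norm (a *\<^sub>R axis k 1 + b *\<^sub>R axis l 1 :: real^'n)"
      unfolding dist_norm by (rule arg_cong[where f = norm]) simp
    also have "\<dots> \<le> norm (a *\<^sub>R axis k 1 :: real^'n) + norm (b *\<^sub>R axis l 1 :: real^'n)"
      by (rule norm_triangle_ineq)
    also have "\<dots> = a + b"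
      using that by (simp add: norm_axis_1)
    also have "\<dots> < min r1 r2"
      using that by (simp add: s_def)
    finally show ?thesis .
  qed
  obtain a b where 1: "0 < a" "a < s" "0 < b" "b < s"
    "f (x + s *\<^sub>R axis i 1 + s *\<^sub>R axis j 1) - f (x + s *\<^sub>R axis i 1) - f (x + s *\<^sub>R axis j 1) + f x
     = s * (s * ?Q (x + a *\<^sub>R axis i 1 + b *\<^sub>R axis j 1))"
    using second_difference_mean_value[OF assms \<open>s > 0\<close>] by blast
  obtain c d where 2: "0 < c" "c < s" "0 < d" "d < s"
    "f (x + s *\<^sub>R axis j 1 + s *\<^sub>R axis i 1) - f (x + s *\<^sub>R axis j 1) - f (x + s *\<^sub>R axis i 1) + f x
     = s * (s * ?P (x + c *\<^sub>R axis j 1 + d *\<^sub>R axis i 1))"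
    using second_difference_mean_value[OF assms \<open>s > 0\<close>] by blast
  \<comment> \<open>The second difference is unchanged when the two directions are swapped.\<close>
  have "s * (s * ?Q (x + a *\<^sub>R axis i 1 + b *\<^sub>R axis j 1)) = s * (s * ?P (x + c *\<^sub>R axis j 1 + d *\<^sub>R axis i 1))"
    unfolding 1(5)[symmetric] 2(5)[symmetric] by (simp add: ac_simps)
  then have "?Q (x + a *\<^sub>R axis i 1 + b *\<^sub>R axis j 1) = ?P (x + c *\<^sub>R axis j 1 + d *\<^sub>R axis i 1)"
    using \<open>s > 0\<close> by simp
  moreover have "dist (?Q (x + a *\<^sub>R axis i 1 + b *\<^sub>R axis j 1)) (?Q x) < e"
    using near[OF 1(1-4)] r(4) by simp
  moreover have "dist (?P (x + c *\<^sub>R axis j 1 + d *\<^sub>R axis i 1)) (?P x) < e"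
    using near[OF 2(1-4)] r(3) by simp
  ultimately show False
    unfolding e_def using dist_triangle_half_l[of "?P x" _ "dist (?P x) (?Q x)" "?Q x"]
    by (metis dist_commute less_irrefl)
qed

section \<open>Pointwise algebra of the Ricci contraction\<close>

text \<open>Moving factors and signs inside the conditional leaves Kronecker sums in the shape that
  the simplifier collapses to a single term.\<close>

lemma mult_delta:
  fixes a b :: real
  shows "a * (if P then b else 0) = (if P then a * b else 0)"
    "(if P then b else 0) * a = (if P then b * a else 0)"
    "- (if P then b else 0) = (if P then - b else 0)"
  by auto

text \<open>With \<open>v\<close> the gradient of \<open>\<psi>\<close>, this is \<open>- \<psi> \<Gamma>\<^sup>l\<^sub>i\<^sub>j\<close>; being linear in \<open>v\<close>, it also
  describes the derivatives of the Christoffel symbols.\<close>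

definition conformal_symbol :: "('n \<Rightarrow> real) \<Rightarrow> 'n \<Rightarrow> 'n \<Rightarrow> 'n \<Rightarrow> ('n \<Rightarrow> real) \<Rightarrow> real" where
  "conformal_symbol \<epsilon> l i j v =
     (if j = l then v i else 0) + (if i = l then v j else 0) - (if i = j then \<epsilon> l * \<epsilon> i * v l else 0)"

text \<open>\<open>p\<close>, \<open>q\<close>, \<open>u\<close> stand for the values at one point of the gradient and Hessian of \<open>\<psi>\<close> and of
  \<open>1/\<psi>\<close>.\<close>

lemma conformal_ricci_algebra:
  fixes \<epsilon> p :: "'n::finite \<Rightarrow> real" and q :: "'n \<Rightarrow> 'n \<Rightarrow> real" and u :: real
  assumes sign: "\<And>i. \<epsilon> i * \<epsilon> i = 1" and sym: "\<And>i j. q i j = q j i"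
  defines "S \<equiv> conformal_symbol \<epsilon>"
  defines "\<Gamma> \<equiv> \<lambda>l i j. - (u * S l i j p)"
  defines "D\<Gamma> \<equiv> \<lambda>a l i j. p a * (u * u) * S l i j p - u * S l i j (q a)"
  shows "(\<Sum>i\<in>UNIV. D\<Gamma> i i j k - D\<Gamma> j i i k + (\<Sum>m\<in>UNIV. \<Gamma> i i m * \<Gamma> m j k - \<Gamma> i j m * \<Gamma> m i k))
     = (real CARD('n) - 2) * u * q j k
       + (if j = k then \<epsilon> j * (u * (\<Sum>m\<in>UNIV. \<epsilon> m * q m m)
           - (real CARD('n) - 1) * u\<^sup>2 * (\<Sum>m\<in>UNIV. \<epsilon> m * (p m)\<^sup>2)) else 0)"
proof -
  let ?n = "real CARD('n)"
  let ?G = "\<Sum>m\<in>UNIV. \<epsilon> m * (p m)\<^sup>2"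
  note expand = S_def conformal_symbol_def algebra_simps sum.distrib sum_subtractf mult_delta
    sum_distrib_left power2_eq_square
  have sign': "\<epsilon> i * (\<epsilon> i * a) = a" for i a
    using sign[of i] by (metis mult.assoc mult_1)
  \<comment> \<open>For \<open>m = i\<close> the first and third terms of the symbol cancel since
    \<open>\<epsilon> i * \<epsilon> i = 1\<close>. The value does not depend on \<open>i\<close>,
    so summing it later produces the factor \<open>n\<close>.\<close>
  have trace: "S i i m v = v m" for i m v
    by (simp add: S_def conformal_symbol_def sign)
  have 1: "(\<Sum>m\<in>UNIV. p m * S m j k p) = 2 * p j * p k - (if j = k then \<epsilon> j * ?G else 0)"
    by (simp add: expand cong: if_cong)
  have 2: "(\<Sum>i\<in>UNIV. S i j k (q i)) = 2 * q j k - (if j = k then \<epsilon> j * (\<Sum>m\<in>UNIV. \<epsilon> m * q m m) else 0)"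
    using sym[of k j] by (simp add: expand cong: if_cong)
  have 3: "(\<Sum>m\<in>UNIV. S i j m p * S m i k p) =
      p j * p k + (if i = k then p j * p i else 0) + (if i = j then p i * p k else 0)
      - (if i = j then (if i = k then \<epsilon> i * ?G else 0) else 0)
      - (if j = k then \<epsilon> j * (\<epsilon> i * (p i)\<^sup>2) else 0)" for i
    by (simp add: expand sign sign' cong: if_cong)
  have 4: "(\<Sum>i\<in>UNIV. \<Sum>m\<in>UNIV. S i j m p * S m i k p)
      = (?n + 2) * p j * p k - 2 * (if j = k then \<epsilon> j * ?G else 0)"
    unfolding 3 by (simp add: algebra_simps sum.distrib sum_subtractf sum_distrib_left cong: if_cong)
  \<comment> \<open>By \<open>trace\<close>, every symbol with its upper index repeated below
    reduces to one component; the rest are the contractions 1, 2 and 4.\<close>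
  have "(\<Sum>i\<in>UNIV. D\<Gamma> i i j k - D\<Gamma> j i i k + (\<Sum>m\<in>UNIV. \<Gamma> i i m * \<Gamma> m j k - \<Gamma> i j m * \<Gamma> m i k))
    = u\<^sup>2 * (\<Sum>i\<in>UNIV. p i * S i j k p) - u * (\<Sum>i\<in>UNIV. S i j k (q i))
      - (\<Sum>i\<in>(UNIV::'n set). p j * u\<^sup>2 * p k - u * q j k)
      + (\<Sum>i\<in>(UNIV::'n set). u\<^sup>2 * (\<Sum>m\<in>UNIV. p m * S m j k p))
      - u\<^sup>2 * (\<Sum>i\<in>UNIV. \<Sum>m\<in>UNIV. S i j m p * S m i k p)"
    by (simp add: D\<Gamma>_def \<Gamma>_def trace sum.distrib sum_subtractf sum_distrib_left power2_eq_square algebra_simps)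
  \<comment> \<open>The terms in \<open>p j * p k\<close> disappear because their coefficients 2,
    -n, 2n and -(n+2) add up to 0. Those of \<open>?G\<close> on the diagonal, -1, -n and 2, add up
    to -(n-1).\<close>
  also have "\<dots> = (?n - 2) * u * q j k
       + (if j = k then \<epsilon> j * (u * (\<Sum>m\<in>UNIV. \<epsilon> m * q m m) - (?n - 1) * u\<^sup>2 * ?G) else 0)"
    unfolding 1 2 4 by (simp add: power2_eq_square algebra_simps)
  finally show ?thesis .
qed

text \<open>\<open>matrix_inv\<close> is a choice among two-sided inverses, and associativity makes
  these unique.\<close>

lemma matrix_inv_eqI: "A ** B = mat 1 \<Longrightarrow> B ** A = mat 1 \<Longrightarrow> matrix_inv A = B"
  for A :: "real^'n::finite^'n"
  unfolding matrix_inv_def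
  by (rule some_equality) (auto, metis matrix_mul_assoc matrix_mul_lid matrix_mul_rid)

section \<open>Curvature and Hessian of the conformal metric\<close>

locale conformally_flat =
  fixes \<epsilon> :: "'n::finite \<Rightarrow> real" and \<psi> :: "real^'n \<Rightarrow> real"
  assumes sign: "\<And>i. \<epsilon> i * \<epsilon> i = 1"
    and smooth_factor: "smooth \<psi>"
    and factor_nonzero: "\<And>x. \<psi> x \<noteq> 0"
begin

abbreviation g where "g \<equiv> conformal_metric \<psi> (pseudo_euclidean \<epsilon>)"
abbreviation p where "p i \<equiv> partial_deriv i \<psi>"
abbreviation u where "u \<equiv> \<lambda>x. inverse (\<psi> x)"
abbreviation Lap where "Lap x \<equiv> \<Sum>m\<in>UNIV. \<epsilon> m * partial_deriv m (p m) x"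
abbreviation Gsq where "Gsq x \<equiv> \<Sum>m\<in>UNIV. \<epsilon> m * (p m x)\<^sup>2"

lemma metric_component: "g x $ i $ j = (if i = j then \<epsilon> i else 0) * (u x * u x)"
  by (simp add: conformal_metric_def pseudo_euclidean_def divide_inverse power2_eq_square)

lemma smooth_inverse_factor: "smooth u"
  by (intro smooth_inverse smooth_factor factor_nonzero)

lemma partial_deriv_metric:
  "partial_deriv a (\<lambda>y. g y $ i $ j) x = (if i = j then \<epsilon> i else 0) * (- 2 * p a x * u x ^ 3)"
  unfolding metric_component
  by (subst partial_deriv_cmult)
    (auto simp: partial_deriv_mult partial_deriv_inverse smooth_differentiable smooth_mult
      smooth_inverse_factor smooth_factor factor_nonzero power3_eq_cube)

definition g_inv :: "real^'n \<Rightarrow> real^'n^'n" where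
  "g_inv x = (\<chi> i j. (if i = j then \<epsilon> i else 0) * (\<psi> x)\<^sup>2)"

lemma metric_inverse: "g x ** g_inv x = mat 1" "g_inv x ** g x = mat 1"
proof -
  have "u x * u x * (\<psi> x)\<^sup>2 = 1"
    using factor_nonzero[of x] by (simp add: field_simps power2_eq_square)
  then have "\<epsilon> i * (u x * u x) * (\<epsilon> i * (\<psi> x)\<^sup>2) = 1" "\<epsilon> i * (\<psi> x)\<^sup>2 * (\<epsilon> i * (u x * u x)) = 1" for i
    using sign[of i] by algebra+
  then show "g x ** g_inv x = mat 1" "g_inv x ** g x = mat 1"
    unfolding matrix_matrix_mult_def vec_eq_iff mat_def g_inv_def
    by (simp_all add: metric_component mult_delta cong: if_cong)
qed

lemma matrix_inv_metric: "matrix_inv (g x) $ i $ j = (if i = j then \<epsilon> i else 0) * (\<psi> x)\<^sup>2"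
  by (simp add: matrix_inv_eqI[OF metric_inverse] g_inv_def)

lemma semi_riemannian: "semi_riemannian_metric g"
  unfolding semi_riemannian_metric_def
proof (intro conjI allI)
  show "smooth (\<lambda>x. g x $ i $ j)" for i j
    unfolding metric_component by (intro smooth_mult smooth_const smooth_inverse_factor)
  show "transpose (g x) = g x" for x
    by (auto simp: transpose_def vec_eq_iff metric_component)
  show "invertible (g x)" for x
    using metric_inverse invertible_def by blast
qed

text \<open>The inverse metric is diagonal, so only \<open>m = l\<close> survives. Its factor
  \<open>\<psi>\<^sup>2\<close> meets the cube of \<open>u\<close> from the differentiated metric,
  leaving a single \<open>u\<close>.\<close>

lemma christoffel_conformal:
  "christoffel g l i j x = - (u x * conformal_symbol \<epsilon> l i j (\<lambda>k. p k x))"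
proof -
  have "christoffel g l i j x = (1/2) * (\<epsilon> l * (\<psi> x)\<^sup>2 *
        (partial_deriv i (\<lambda>y. g y $ j $ l) x
         + partial_deriv j (\<lambda>y. g y $ i $ l) x
         - partial_deriv l (\<lambda>y. g y $ i $ j) x))"
    unfolding christoffel_def matrix_inv_metric by (simp add: mult_delta cong: if_cong)
  also have "\<dots> = - (((\<psi> x)\<^sup>2 * u x ^ 3) * (\<epsilon> l *
      ((if j = l then \<epsilon> j else 0) * p i x + (if i = l then \<epsilon> i else 0) * p j x
        - (if i = j then \<epsilon> i else 0) * p l x)))"
    unfolding partial_deriv_metric by (simp add: algebra_simps)
  also have "(\<psi> x)\<^sup>2 * u x ^ 3 = u x"
    using factor_nonzero[of x] by (simp add: field_simps power2_eq_square power3_eq_cube)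
  also have "\<epsilon> l * ((if j = l then \<epsilon> j else 0) * p i x + (if i = l then \<epsilon> i else 0) * p j x
        - (if i = j then \<epsilon> i else 0) * p l x) = conformal_symbol \<epsilon> l i j (\<lambda>k. p k x)"
    using sign[of l] by (simp add: conformal_symbol_def distrib_left right_diff_distrib mult.assoc[symmetric])
  finally show ?thesis .
qed

text \<open>With the conditionals turned into constant coefficients, the sum and constant-multiple
  rules differentiate the symbol term by term.\<close>

lemma conformal_symbol_linear:
  "conformal_symbol \<epsilon> l i j v = (if j = l then 1 else 0) * v i + (if i = l then 1 else 0) * v j
     + (if i = j then - \<epsilon> l * \<epsilon> i else 0) * v l"
  by (simp add: conformal_symbol_def)

lemma partial_deriv_christoffel:
  "partial_deriv a (christoffel g l i j) x =
     p a x * (u x * u x) * conformal_symbol \<epsilon> l i j (\<lambda>k. p k x)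
     - u x * conformal_symbol \<epsilon> l i j (\<lambda>k. partial_deriv a (p k) x)"
proof -
  have diff: "p k differentiable (at x)" for k
    by (intro smooth_differentiable smooth_partial_deriv smooth_factor)
  have S: "(\<lambda>y. conformal_symbol \<epsilon> l i j (\<lambda>k. p k y)) differentiable (at x)"
    "partial_deriv a (\<lambda>y. conformal_symbol \<epsilon> l i j (\<lambda>k. p k y)) x
      = conformal_symbol \<epsilon> l i j (\<lambda>k. partial_deriv a (p k) x)"
    unfolding conformal_symbol_linear by (simp_all add: diff partial_deriv_add partial_deriv_cmult)
  have eq: "christoffel g l i j = (\<lambda>y. (-1) * (u y * conformal_symbol \<epsilon> l i j (\<lambda>k. p k y)))"
    by (auto simp: christoffel_conformal)
  have du: "u differentiable (at x)"
    by (intro smooth_differentiable smooth_inverse_factor)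
  have pu: "partial_deriv a u x = - (p a x * (u x * u x))"
    by (simp add: partial_deriv_inverse smooth_differentiable smooth_factor factor_nonzero)
  show ?thesis
    unfolding eq partial_deriv_cmult[OF differentiable_mult[OF du S(1)]] partial_deriv_mult[OF du S(1)] S(2) pu
    by (simp add: algebra_simps)
qed

text \<open>An instance of \<open>conformal_ricci_algebra\<close> at each point; its symmetry
  hypothesis on \<open>q\<close> is the equality of mixed partial derivatives of
  \<open>\<psi>\<close>.\<close>

lemma ricci_conformal:
  "ricci g j k x = (real CARD('n) - 2) * u x * partial_deriv j (p k) x
     + (if j = k then \<epsilon> j * (u x * Lap x - (real CARD('n) - 1) * (u x)\<^sup>2 * Gsq x) else 0)"
  unfolding ricci_def riemann_def partial_deriv_christoffel christoffel_conformal
  by (rule conformal_ricci_algebra) (rule sign, rule partial_deriv_commute, rule smooth_factor)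

lemma square_factor_mult_inverse: "(\<psi> x)\<^sup>2 * u x = \<psi> x"
  and square_factor_mult_inverse_square: "(\<psi> x)\<^sup>2 * (u x)\<^sup>2 = 1"
  using factor_nonzero[of x] by (simp_all add: power2_eq_square field_simps)

lemma scalar_curvature_conformal:
  "scalar_curvature g x = (real CARD('n) - 1) * (2 * \<psi> x * Lap x - real CARD('n) * Gsq x)"
proof -
  let ?n = "real CARD('n)"
  \<comment> \<open>Powers of \<open>\<psi>\<close> and \<open>u\<close> stay grouped so that they
    can be replaced by \<open>\<psi>\<close> and 1 at the end. Tracing the diagonal part of Ricci
    gives \<open>n\<close> equal terms.\<close>
  have "scalar_curvature g x = (\<Sum>i\<in>UNIV. (?n - 2) * ((\<psi> x)\<^sup>2 * u x) * (\<epsilon> i * partial_deriv i (p i) x)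
      + (\<epsilon> i * \<epsilon> i) * (((\<psi> x)\<^sup>2 * u x) * Lap x - (?n - 1) * ((\<psi> x)\<^sup>2 * (u x)\<^sup>2) * Gsq x))"
    unfolding scalar_curvature_def matrix_inv_metric
    by (simp add: mult_delta ricci_conformal cong: if_cong) (simp add: algebra_simps)
  also have "\<dots> = (?n - 2) * ((\<psi> x)\<^sup>2 * u x) * Lap x
      + ?n * (((\<psi> x)\<^sup>2 * u x) * Lap x - (?n - 1) * ((\<psi> x)\<^sup>2 * (u x)\<^sup>2) * Gsq x)"
    by (simp add: sign sum.distrib flip: sum_distrib_left)
  also note square_factor_mult_inverse
  also note square_factor_mult_inverse_square
  finally show ?thesis
    by (simp add: algebra_simps)
qed

lemma hessian_conformal:
  "hessian g h i j x = partial_deriv i (partial_deriv j h) x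
     + u x * (p i x * partial_deriv j h x + p j x * partial_deriv i h x
         - (if i = j then \<epsilon> i * (\<Sum>k\<in>UNIV. \<epsilon> k * p k x * partial_deriv k h x) else 0))"
  unfolding hessian_def christoffel_conformal
  by (simp add: conformal_symbol_def algebra_simps sum.distrib sum_subtractf mult_delta sum_negf
      sum_distrib_left cong: if_cong)

section \<open>The soliton equation as a system for the two functions\<close>

lemma soliton_equations:
  assumes "CARD('n) \<ge> 3" "\<rho> \<noteq> 0" "smooth h"
  shows "soliton_with_constant g h \<rho> lam \<longleftrightarrow> off_diagonal_equations \<psi> h \<and> diagonal_equations \<epsilon> \<rho> lam \<psi> h"
proof -
  let ?n = "real CARD('n)"
  let ?H = "\<lambda>i j. partial_deriv i (partial_deriv j h)" and ?h = "\<lambda>i. partial_deriv i h"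
  let ?W = "\<lambda>x. \<Sum>k\<in>UNIV. \<epsilon> k * p k x * ?h k x"
  define E where "E x i j \<longleftrightarrow> ricci g i j x + hessian g h i j x
        = \<rho> * scalar_curvature g x * (g x $ i $ j) + lam * (g x $ i $ j)" for x i j
  \<comment> \<open>Here the metric component is zero, so neither \<open>\<rho>\<close> nor
    \<open>lam\<close> enters, and the nonzero factor \<open>u x\<close> can be cancelled. Symmetry
    of mixed derivatives reconciles the order of differentiation.\<close>
  have off: "E x i j \<longleftrightarrow> (?n - 2) * partial_deriv j (p i) x + \<psi> x * ?H j i x
        + p i x * ?h j x + p j x * ?h i x = 0" (is "_ \<longleftrightarrow> ?R = 0") if "i \<noteq> j" for x i j
  proof -
    have "ricci g i j x + hessian g h i j x = u x * ?R"
      using that factor_nonzero[of x] partial_deriv_commute[OF smooth_factor, of i j x]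
        partial_deriv_commute[OF \<open>smooth h\<close>, of i j x]
      by (simp add: ricci_conformal hessian_conformal field_simps)
    then show ?thesis
      using that factor_nonzero[of x] by (simp add: E_def metric_component)
  qed
  \<comment> \<open>The sum over \<open>k\<close> involves the derivatives only through three
    scalars: the squared gradient, the Laplacian and the pairing of the two gradients.\<close>
  have sum: "(\<Sum>k\<in>UNIV. \<epsilon> k *
            ((?n - 1) * (\<rho> * ?n * (p k x)\<^sup>2 - 2 * \<rho> * \<psi> x * partial_deriv k (p k) x - (p k x)\<^sup>2)
             - \<psi> x * p k x * ?h k x + \<psi> x * partial_deriv k (p k) x))
      = (?n - 1) * (\<rho> * ?n * Gsq x - 2 * \<rho> * \<psi> x * Lap x - Gsq x) - \<psi> x * ?W x + \<psi> x * Lap x" for x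
    by (simp add: algebra_simps sum.distrib sum_subtractf sum_distrib_left)
  have diag: "E x i i \<longleftrightarrow>
      \<psi> x * ((?n - 2) * partial_deriv i (p i) x + \<psi> x * ?H i i x + 2 * p i x * ?h i x)
        + \<epsilon> i * ((?n - 1) * (\<rho> * ?n * Gsq x - 2 * \<rho> * \<psi> x * Lap x - Gsq x) - \<psi> x * ?W x + \<psi> x * Lap x)
      = lam * \<epsilon> i" (is "_ \<longleftrightarrow> ?L = _") for x i
  proof -
    have "(\<psi> x)\<^sup>2 * (ricci g i i x + hessian g h i i x
        - (\<rho> * scalar_curvature g x * (g x $ i $ i) + lam * (g x $ i $ i)))
      = ((\<psi> x)\<^sup>2 * u x) * ((?n - 2) * partial_deriv i (p i) x + \<epsilon> i * Lap x
          + 2 * p i x * ?h i x - \<epsilon> i * ?W x)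
        - ((\<psi> x)\<^sup>2 * (u x)\<^sup>2) * \<epsilon> i * ((?n - 1) * Gsq x + \<rho> * scalar_curvature g x + lam)
        + (\<psi> x)\<^sup>2 * ?H i i x"
      unfolding ricci_conformal hessian_conformal metric_component
      by (simp add: algebra_simps power2_eq_square)
    \<comment> \<open>Inserting the scalar curvature produces all the terms in
      \<open>\<rho>\<close>, and \<open>lam\<close> keeps only the factor
      \<open>\<epsilon> i\<close>.\<close>
    also have "\<dots> = ?L - lam * \<epsilon> i"
      unfolding square_factor_mult_inverse square_factor_mult_inverse_square scalar_curvature_conformal
      by (simp add: algebra_simps power2_eq_square)
    finally have eq: "(\<psi> x)\<^sup>2 * (ricci g i i x + hessian g h i i x
        - (\<rho> * scalar_curvature g x * (g x $ i $ i) + lam * (g x $ i $ i))) = ?L - lam * \<epsilon> i" .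
    have "E x i i \<longleftrightarrow> (\<psi> x)\<^sup>2 * (ricci g i i x + hessian g h i i x
        - (\<rho> * scalar_curvature g x * (g x $ i $ i) + lam * (g x $ i $ i))) = 0"
      unfolding E_def mult_eq_0_iff right_minus_eq using factor_nonzero[of x] by simp
    then show ?thesis
      unfolding eq right_minus_eq .
  qed
  have "soliton_with_constant g h \<rho> lam \<longleftrightarrow> (\<forall>x i j. E x i j)"
    using assms semi_riemannian by (simp add: soliton_with_constant_def E_def)
  also have "\<dots> \<longleftrightarrow> (\<forall>x i j. i \<noteq> j \<longrightarrow> E x i j) \<and> (\<forall>x i. E x i i)"
    by (intro iffI allI) (simp, metis)
  finally show ?thesis
    unfolding off_diagonal_equations_def diagonal_equations_def sum by (simp add: off diag)
qed

end

theorem theorem1p2: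
  fixes \<epsilon> :: "'n::finite \<Rightarrow> real" and \<rho> :: real and h :: "real^'n \<Rightarrow> real"
  assumes "CARD('n) \<ge> 3"
    and "\<And>i. \<epsilon> i = 1 \<or> \<epsilon> i = -1"
    and "\<rho> \<noteq> 0"
    and "smooth h"
  shows "(\<forall>\<psi> lam. conformal_factor \<psi> \<longrightarrow>
            (soliton_with_constant (conformal_metric \<psi> (pseudo_euclidean \<epsilon>)) h \<rho> lam
             \<longleftrightarrow> off_diagonal_equations \<psi> h \<and> diagonal_equations \<epsilon> \<rho> lam \<psi> h))
       \<and> ((\<exists>\<psi>. conformal_factor \<psi> \<and>
              gradient_rho_einstein_soliton (conformal_metric \<psi> (pseudo_euclidean \<epsilon>)) h \<rho>)
          \<longleftrightarrow> (\<exists>\<psi> lam. conformal_factor \<psi> \<and>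
              off_diagonal_equations \<psi> h \<and> diagonal_equations \<epsilon> \<rho> lam \<psi> h))"
proof -
  have "\<epsilon> i * \<epsilon> i = 1" for i
    using assms(2)[of i] by auto
  then have main: "soliton_with_constant (conformal_metric \<psi> (pseudo_euclidean \<epsilon>)) h \<rho> lam
      \<longleftrightarrow> off_diagonal_equations \<psi> h \<and> diagonal_equations \<epsilon> \<rho> lam \<psi> h"
    if "conformal_factor \<psi>" for \<psi> lam
    using that assms
    by (intro conformally_flat.soliton_equations conformally_flat.intro)
      (auto simp: conformal_factor_def)
  \<comment> \<open>\<open>main\<close> holds for each \<open>\<psi>\<close> and \<open>lam\<close>
    separately, so the existence statement uses the same witnesses in both directions.\<close>
  then show ?thesis
    unfolding gradient_rho_einstein_soliton_def by metis
qed

end
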